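(* For every $e\geq 0$, the polynomial $$\psi_e=(-1)^e\sum_{n=0}^{3\cdot 2^e}t(3\cdot 2^e+n)z^n$$ satisfies $$\psi_e=z(1+z^{2^e})(1+z+z^2)^e\prod_{n=0}^{e-2}\left(1-z^{2^n}+z^{2^{n+1}}\right)^{e-1-n}=z(1+z^{2^e})\prod_{n=0}^{e-1}\left(1+z^{2^n}+z^{2^{n+1}}\right).$$
   Context: The twisted Stern sequence $t$ is defined by $t(0)=0$, $t(1)=1$, $t(2n)=-t(n)$, $t(2n+1)=-t(n)-t(n+1)$ for $n\geq 1$. Empty products equal $1$. *)

theory Defs
  imports "HOL-Computational_Algebra.Polynomial"
begin

function twisted_stern :: "nat \<Rightarrow> int" where
  "twisted_stern 0 = 0"
| "twisted_stern (Suc 0) = 1"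
| "n \<ge> 1 \<Longrightarrow> twisted_stern (2 * n) = - twisted_stern n"
| "n \<ge> 1 \<Longrightarrow> twisted_stern (2 * n + 1) = - twisted_stern n - twisted_stern (n + 1)"
proof -
  fix P :: bool and x :: nat
  assume zero: "x = 0 \<Longrightarrow> P" and one: "x = Suc 0 \<Longrightarrow> P"
    and even: "\<And>n. n \<ge> 1 \<Longrightarrow> x = 2 * n \<Longrightarrow> P"
    and odd: "\<And>n. n \<ge> 1 \<Longrightarrow> x = 2 * n + 1 \<Longrightarrow> P"
  have "x = 0 \<or> x = Suc 0 \<or> (x div 2 \<ge> 1 \<and> (x = 2 * (x div 2) \<or> x = 2 * (x div 2) + 1))"
    by presburger
  then show P
    using zero one even odd by blast
qed (presburger | simp)+
termination
  by (relation "measure id") auto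

abbreviation zvar :: "int poly" where
  "zvar \<equiv> [:0, 1:]"

definition psi :: "nat \<Rightarrow> int poly" where
  "psi e = (-1) ^ e * (\<Sum>n = 0..3 * 2 ^ e. of_int (twisted_stern (3 * 2 ^ e + n)) * zvar ^ n)"

end

(* Since t(3 * 2^e) = 0, splitting psi (e + 1) into even and odd powers gives
   z * psi_(e+1)(z) = (1 + z + z^2) * psi_e(z^2), and the second product satisfies the same recursion.
   The first product follows from 1 + w^2 + w^4 = (1 + w + w^2) * (1 - w + w^2). *)
theory Submission
  imports Defs
begin

text \<open>At 3 the values at 1 and 2 are opposite and cancel; doubling the argument only changes
  the sign.\<close>

lemma twisted_stern_three_power [simp]: "twisted_stern (3 * 2 ^ e) = 0"
proof (induction e)
  case 0
  show ?case
    using twisted_stern.simps(3)[of 1] twisted_stern.simps(4)[of 1] by (simp add: numeral_eq_Suc)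
next
  case (Suc e)
  then show ?case
    using twisted_stern.simps(3)[of "3 * 2 ^ e"] by (simp add: mult.left_commute)
qed

text \<open>The factor \<open>x\<close> on the left avoids dividing by \<open>x\<close>; the terms on the right without the
  factor \<open>1 + x + x\<^sup>2\<close> are boundary terms.\<close>

lemma twisted_stern_partial_sum:
  fixes x :: "'a :: comm_ring_1"
  assumes "N \<ge> 1"
  shows "x * (\<Sum>m = 0..2 * K. of_int (twisted_stern (2 * N + m)) * x ^ m) =
    - (1 + x + x ^ 2) * (\<Sum>n = 0..K. of_int (twisted_stern (N + n)) * (x ^ 2) ^ n)
    + of_int (twisted_stern (N + K)) * x ^ (2 * K + 2) + of_int (twisted_stern N)"
proof (induction K)
  case 0
  show ?case
    using assms twisted_stern.simps(3)[of N] by (simp add: algebra_simps power2_eq_square)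
next
  case (Suc K)
  have odd: "twisted_stern (Suc (2 * N + 2 * K)) = - twisted_stern (N + K) - twisted_stern (Suc (N + K))"
    using twisted_stern.simps(4)[of "N + K"] assms by (simp add: algebra_simps)
  have even: "twisted_stern (Suc (Suc (2 * N + 2 * K))) = - twisted_stern (Suc (N + K))"
    using twisted_stern.simps(3)[of "Suc (N + K)"] by (simp add: algebra_simps)
  \<comment> \<open>The \<open>twisted_stern (N + K)\<close> part of the new odd term cancels the
    old boundary term at \<open>x ^ (2 * K + 2)\<close>.\<close>
  have "x * (\<Sum>m = 0..2 * Suc K. of_int (twisted_stern (2 * N + m)) * x ^ m) =
      x * (\<Sum>m = 0..2 * K. of_int (twisted_stern (2 * N + m)) * x ^ m)
      + x * of_int (- twisted_stern (N + K) - twisted_stern (Suc (N + K))) * x ^ (2 * K + 1)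
      + x * of_int (- twisted_stern (Suc (N + K))) * x ^ (2 * K + 2)"
    by (simp add: odd even distrib_left right_diff_distrib left_diff_distrib mult.assoc)
  then show ?case
    unfolding Suc.IH by (simp add: algebra_simps power2_eq_square power_mult)
qed

lemma pcompose_power: "(p ^ n) \<circ>\<^sub>p q = (p \<circ>\<^sub>p q) ^ n" for p q :: "'a :: comm_semiring_1 poly"
  by (induction n) (simp_all add: pcompose_mult pcompose_1)

text \<open>For \<open>N = K = 3 * 2 ^ e\<close> both boundary terms of the partial sum vanish, and
  the extra sign of \<open>psi (Suc e)\<close> absorbs the minus.\<close>

lemma psi_Suc: "zvar * psi (Suc e) = (1 + zvar + zvar ^ 2) * (psi e \<circ>\<^sub>p zvar ^ 2)"
proof -
  let ?N = "3 * 2 ^ e :: nat"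
  let ?S = "\<Sum>n = 0..?N. of_int (twisted_stern (?N + n)) * (zvar ^ 2) ^ n"
  have zero: "twisted_stern (?N + ?N) = 0"
    using twisted_stern_three_power[of "Suc e"] by (simp add: algebra_simps)
  have "zvar * psi (Suc e) = (-1) ^ Suc e *
      (zvar * (\<Sum>m = 0..2 * ?N. of_int (twisted_stern (2 * ?N + m)) * zvar ^ m))"
    unfolding psi_def power_Suc by (simp only: mult_ac)
  also have "zvar * (\<Sum>m = 0..2 * ?N. of_int (twisted_stern (2 * ?N + m)) * zvar ^ m) =
      - ((1 + zvar + zvar ^ 2) * ?S)"
    using twisted_stern_partial_sum[of ?N zvar ?N]
    by (simp only: zero twisted_stern_three_power of_int_0 mult_zero_left add_0_right mult_minus_left)
      simp
  also have "(-1) ^ Suc e * - ((1 + zvar + zvar ^ 2) * ?S) = (1 + zvar + zvar ^ 2) * ((-1) ^ e * ?S)"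
    by (simp only: power_Suc mult_minus_left mult_minus_right mult_1_left minus_minus mult.left_commute)
  \<comment> \<open>Composition fixes the sign and the integer coefficients and only replaces
    \<open>zvar\<close> by its square.\<close>
  also have "(-1) ^ e * ?S = psi e \<circ>\<^sub>p zvar ^ 2"
  proof -
    have "(of_int k :: int poly) \<circ>\<^sub>p q = of_int k" for k q
      by (simp add: of_int_poly pcompose_const)
    moreover have "(-1 :: int poly) \<circ>\<^sub>p q = -1" for q
      by (simp add: pcompose_uminus pcompose_1)
    moreover have "zvar \<circ>\<^sub>p q = q" for q
      by (simp add: pcompose_pCons)
    ultimately show ?thesis
      unfolding psi_def pcompose_mult pcompose_sum pcompose_power by presburger
  qed
  finally show ?thesis .
qed

lemma psi_eq_prod:
  "psi e = zvar * (1 + zvar ^ (2 ^ e)) * (\<Prod>n = 0..<e. 1 + zvar ^ (2 ^ n) + zvar ^ (2 ^ (n + 1)))"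
proof (induction e)
  case 0
  \<comment> \<open>These four coefficients give \<open>psi 0 = zvar + zvar ^ 2\<close>.\<close>
  have "twisted_stern 3 = 0" "twisted_stern 4 = 1" "twisted_stern 5 = 1" "twisted_stern 6 = 0"
    using twisted_stern_three_power[of 0] twisted_stern_three_power[of 1]
      twisted_stern.simps(3)[of 1] twisted_stern.simps(3)[of 2] twisted_stern.simps(4)[of 2]
    by (simp_all add: numeral_eq_Suc)
  then show ?case
    by (simp add: psi_def numeral_eq_Suc one_pCons)
next
  case (Suc e)
  have z: "zvar \<circ>\<^sub>p q = q" for q
    by (simp add: pcompose_pCons)
  have "zvar * psi (Suc e) = (1 + zvar + zvar ^ 2) * (zvar ^ 2 * (1 + zvar ^ (2 ^ Suc e)) *
      (\<Prod>n = 0..<e. 1 + zvar ^ (2 ^ Suc n) + zvar ^ (2 ^ (Suc n + 1))))"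
    unfolding psi_Suc Suc.IH pcompose_mult pcompose_prod pcompose_add pcompose_power z pcompose_1
    by (simp only: power_mult[symmetric] power_Suc add_Suc)
  \<comment> \<open>Squaring the variable shifted every factor up by one index;
    \<open>1 + zvar + zvar ^ 2\<close> supplies the missing factor \<open>n = 0\<close>.\<close>
  also have "\<dots> = zvar * (zvar * (1 + zvar ^ (2 ^ Suc e)) *
      (\<Prod>n = 0..<Suc e. 1 + zvar ^ (2 ^ n) + zvar ^ (2 ^ (n + 1))))"
    by (subst prod.atLeast0_lessThan_Suc_shift)
      (simp add: power2_eq_square mult_ac del: mult_pCons_left mult_pCons_right)
  finally show ?case
    by (simp only: mult_cancel_left) simp
qed

text \<open>The trinomial of index \<open>k\<close> splits into \<open>1 + x + x ^ 2\<close> and the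
  factors \<open>1 - x ^ (2 ^ n) + x ^ (2 ^ (n + 1))\<close> with \<open>n < k\<close>. So factor
  \<open>n\<close> occurs once for each \<open>k\<close> from \<open>n + 1\<close> to
  \<open>e - 1\<close>.\<close>

lemma prod_trinomials:
  fixes x :: "'a :: comm_ring_1"
  shows "(\<Prod>n = 0..<e. 1 + x ^ (2 ^ n) + x ^ (2 ^ (n + 1))) =
    (1 + x + x ^ 2) ^ e * (\<Prod>n = 0..<e - 1. (1 - x ^ (2 ^ n) + x ^ (2 ^ (n + 1))) ^ (e - 1 - n))"
proof (induction e)
  case 0
  show ?case by simp
next
  case (Suc e)
  let ?B = "\<lambda>n. 1 - x ^ (2 ^ n) + x ^ (2 ^ (n + 1))"
  have telescope: "1 + x ^ (2 ^ k) + x ^ (2 ^ (k + 1)) = (1 + x + x ^ 2) * (\<Prod>n = 0..<k. ?B n)" for k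
  proof (induction k)
    case 0
    show ?case by simp
  next
    case (Suc k)
    have "1 + x ^ (2 ^ Suc k) + x ^ (2 ^ (Suc k + 1)) = (1 + x ^ (2 ^ k) + x ^ (2 ^ (k + 1))) * ?B k"
      by (simp add: algebra_simps power2_eq_square flip: power_add mult_2 mult_2_right)
    then show ?case
      by (simp only: Suc.IH prod.atLeast0_lessThan_Suc mult.assoc)
  qed
  have "(\<Prod>n = 0..<e. ?B n ^ (e - n)) = (\<Prod>n = 0..<e. ?B n ^ (e - 1 - n) * ?B n)"
    by (intro prod.cong refl) (simp flip: power_Suc2 add: Suc_diff_Suc)
  \<comment> \<open>The index \<open>n = e - 1\<close> drops out because its exponent is 0; for
    \<open>e = 0\<close> all products are empty.\<close>
  also have "\<dots> = (\<Prod>n = 0..<e - 1. ?B n ^ (e - 1 - n)) * (\<Prod>n = 0..<e. ?B n)"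
    by (cases e) (simp_all add: prod.distrib)
  finally show ?case
    by (simp only: prod.atLeast0_lessThan_Suc[of _ e] Suc.IH telescope[of e] diff_Suc_1 power_Suc mult_ac)
qed

theorem mainTheorem3:
  fixes e :: nat
  shows "psi e = zvar * (1 + zvar ^ (2 ^ e)) * (1 + zvar + zvar ^ 2) ^ e *
             (\<Prod>n = 0..<e - 1. (1 - zvar ^ (2 ^ n) + zvar ^ (2 ^ (n + 1))) ^ (e - 1 - n))
       \<and> psi e = zvar * (1 + zvar ^ (2 ^ e)) *
             (\<Prod>n = 0..<e. 1 + zvar ^ (2 ^ n) + zvar ^ (2 ^ (n + 1)))"
  using psi_eq_prod[of e] psi_eq_prod[of e, unfolded prod_trinomials[of zvar e]]
  by (simp only: mult.assoc simp_thms)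

end
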